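(* Fix $0<q<1$. The $q$-entropy map $\mathcal{M}_{\mathrm{inv}}(\sigma)\ni\mu\mapsto H_q(\mu)$ is concave.
   Context: $\Omega=\{1,\dots,d\}^{\mathbb N}$, $\sigma:\Omega\to\Omega$ is the one-sided shift, $\mathcal{M}_{\mathrm{inv}}(\sigma)$ is the convex set of $\sigma$-invariant Borel probability measures on $\Omega$, and $\mathcal{C}^+$ is the set of continuous strictly positive functions on $\Omega$. For $x\in\Omega$ and $a\in\{1,\dots,d\}$, $ax$ is the sequence obtained by placing $a$ in front of $x$. For $0<q<1$ and $u>0$, $\log_q(u)=\frac{1}{1-q}(u^{1-q}-1)$. For $\mu\in\mathcal{M}_{\mathrm{inv}}(\sigma)$ the $q$-entropy is $$H_q(\mu)=\inf_{u\in\mathcal{C}^+}\int\log_q\Big(\frac{\sum_{a=1}^du(ax)}{u(x)}\Big)\,d\mu(x).$$ *)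

theory Defs
  imports "HOL-Probability.Probability"
begin

text \<open>Sequences are functions of type \<^typ>\<open>nat \<Rightarrow> nat\<close>, a type that carries the product topology
  over the discrete topology of \<^typ>\<open>nat\<close>.  The full shift on \<open>d\<close> symbols is a subset
  of this type and carries the subspace topology, which is the usual topology of
  \<open>{1,...,d}\<^sup>\<nat>\<close>.\<close>

definition shift_space :: "nat \<Rightarrow> (nat \<Rightarrow> nat) set" where
  "shift_space d = {x. \<forall>n. x n \<in> {1..d}}"

definition shift :: "(nat \<Rightarrow> nat) \<Rightarrow> (nat \<Rightarrow> nat)" where
  "shift x = (\<lambda>n. x (Suc n))"

definition prepend :: "nat \<Rightarrow> (nat \<Rightarrow> nat) \<Rightarrow> (nat \<Rightarrow> nat)" where
  "prepend a x = (\<lambda>n. case n of 0 \<Rightarrow> a | Suc m \<Rightarrow> x m)"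

abbreviation shift_borel :: "nat \<Rightarrow> (nat \<Rightarrow> nat) measure" where
  "shift_borel d \<equiv> restrict_space borel (shift_space d)"

definition invariant_measures :: "nat \<Rightarrow> (nat \<Rightarrow> nat) measure set" where
  "invariant_measures d =
     {\<mu>. prob_space \<mu> \<and> sets \<mu> = sets (shift_borel d) \<and>
         (\<forall>A\<in>sets \<mu>. emeasure \<mu> (shift -` A \<inter> space \<mu>) = emeasure \<mu> A)}"

text \<open>Only the values on \<^term>\<open>shift_space d\<close> matter; outside of it the functions below
  are arbitrary.\<close>

definition pos_continuous :: "nat \<Rightarrow> ((nat \<Rightarrow> nat) \<Rightarrow> real) set" where
  "pos_continuous d =
     {u. continuous_on (shift_space d) u \<and> (\<forall>x\<in>shift_space d. u x > 0)}"

definition q_log :: "real \<Rightarrow> real \<Rightarrow> real" where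
  "q_log q u = 1 / (1 - q) * (u powr (1 - q) - 1)"

definition q_entropy :: "real \<Rightarrow> nat \<Rightarrow> (nat \<Rightarrow> nat) measure \<Rightarrow> real" where
  "q_entropy q d \<mu> =
     (INF u\<in>pos_continuous d. \<integral>x. q_log q ((\<Sum>a\<in>{1..d}. u (prepend a x)) / u x) \<partial>\<mu>)"

text \<open>For \<open>0 < q < 1\<close> the infimum is a genuine one: it ranges over a nonempty set of reals
  that is bounded below.  The integrands are continuous on the compact set
  \<^term>\<open>shift_space d\<close>, hence bounded and integrable, so the integral is a genuine one too.\<close>

lemma q_entropy_bdd_below:
  assumes "0 < q" "q < 1" "\<mu> \<in> invariant_measures d"
  shows "bdd_below ((\<lambda>u. \<integral>x. q_log q ((\<Sum>a\<in>{1..d}. u (prepend a x)) / u x) \<partial>\<mu>) ` pos_continuous d)"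
proof (rule bdd_belowI2)
  fix u :: "(nat \<Rightarrow> nat) \<Rightarrow> real"
  interpret prob_space \<mu> using assms(3) by (simp add: invariant_measures_def)
  let ?f = "\<lambda>x. q_log q ((\<Sum>a\<in>{1..d}. u (prepend a x)) / u x)"
  have lower: "- (1 / (1 - q)) \<le> ?f x" for x
  proof -
    have "1 / (1 - q) * (- 1) \<le> ?f x"
      unfolding q_log_def using assms(2) by (intro mult_left_mono) auto
    then show ?thesis by simp
  qed
  show "- (1 / (1 - q)) \<le> (\<integral>x. ?f x \<partial>\<mu>)"
  proof (cases "integrable \<mu> ?f")
    case True
    then have "(\<integral>x. - (1 / (1 - q)) \<partial>\<mu>) \<le> (\<integral>x. ?f x \<partial>\<mu>)"
      by (intro integral_mono) (use lower in auto)
    then show ?thesis by (simp add: prob_space)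
  next
    case False
    then show ?thesis using assms(2) by (simp add: not_integrable_integral_eq)
  qed
qed

lemma pos_continuous_nonempty: "(\<lambda>_. 1) \<in> pos_continuous d"
  by (simp add: pos_continuous_def)

text \<open>Measures do not form a real vector space type, so \<open>(1 - t) \<mu> + t \<nu>\<close> and concavity
  on a set of measures are defined by hand.  As with \<^const>\<open>concave_on\<close>, concavity includes
  convexity of the domain.\<close>

definition mix_measure :: "real \<Rightarrow> 'a measure \<Rightarrow> 'a measure \<Rightarrow> 'a measure" where
  "mix_measure t \<mu> \<nu> = measure_of (space \<mu>) (sets \<mu>)
     (\<lambda>A. ennreal (1 - t) * emeasure \<mu> A + ennreal t * emeasure \<nu> A)"

lemma sets_mix_measure [simp]: "sets (mix_measure t \<mu> \<nu>) = sets \<mu>"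
  by (simp add: mix_measure_def)

lemma emeasure_mix_measure:
  assumes "sets \<nu> = sets \<mu>" "A \<in> sets \<mu>"
  shows "emeasure (mix_measure t \<mu> \<nu>) A =
    ennreal (1 - t) * emeasure \<mu> A + ennreal t * emeasure \<nu> A"
  unfolding mix_measure_def
proof (rule emeasure_measure_of_sigma)
  show "sigma_algebra (space \<mu>) (sets \<mu>)" by (rule sets.sigma_algebra_axioms)
  show "positive (sets \<mu>) (\<lambda>A. ennreal (1 - t) * emeasure \<mu> A + ennreal t * emeasure \<nu> A)"
    by (simp add: positive_def)
  show "countably_additive (sets \<mu>)
      (\<lambda>A. ennreal (1 - t) * emeasure \<mu> A + ennreal t * emeasure \<nu> A)"
  proof (rule countably_additiveI)
    fix B :: "nat \<Rightarrow> 'a set"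
    assume B: "range B \<subseteq> sets \<mu>" "disjoint_family B"
    then have "(\<Sum>i. emeasure \<mu> (B i)) = emeasure \<mu> (\<Union>i. B i)"
      "(\<Sum>i. emeasure \<nu> (B i)) = emeasure \<nu> (\<Union>i. B i)"
      using assms(1) by (auto intro!: suminf_emeasure)
    then show "(\<Sum>i. ennreal (1 - t) * emeasure \<mu> (B i) + ennreal t * emeasure \<nu> (B i)) =
        ennreal (1 - t) * emeasure \<mu> (\<Union>i. B i) + ennreal t * emeasure \<nu> (\<Union>i. B i)"
      by (simp add: suminf_add[symmetric])
  qed
qed (use assms in auto)

definition concave_on_measures :: "'a measure set \<Rightarrow> ('a measure \<Rightarrow> real) \<Rightarrow> bool" where
  "concave_on_measures S F \<longleftrightarrow>
     (\<forall>\<mu>\<in>S. \<forall>\<nu>\<in>S. \<forall>t\<in>{0..1}. mix_measure t \<mu> \<nu> \<in> S \<and>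
        (1 - t) * F \<mu> + t * F \<nu> \<le> F (mix_measure t \<mu> \<nu>))"

end

theory Submission
  imports Defs
begin

text \<open>For each fixed \<open>u\<close> the integral of the q-logarithm of the ratio is an
  affine function of the measure, and a pointwise infimum of affine functions is concave. Affinity
  is \<open>integral_mix_measure\<close>, obtained from its nonnegative version
  \<open>nn_integral_mix_measure\<close>. It requires integrable integrands: these are continuous
  (\<open>continuous_on_q_log_ratio\<close>) on a compact space
  (\<open>compact_shift_space\<close>), hence bounded. Convexity of the domain,
  \<open>mix_measure_in_invariant_measures\<close>, holds because total mass and invariance are
  preserved by convex combinations.\<close>

lemma nn_integral_mix_measure:
  assumes sets: "sets \<nu> = sets \<mu>" and f: "f \<in> borel_measurable \<mu>"
  shows "(\<integral>\<^sup>+x. f x \<partial>mix_measure t \<mu> \<nu>) =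
    ennreal (1 - t) * (\<integral>\<^sup>+x. f x \<partial>\<mu>) + ennreal t * (\<integral>\<^sup>+x. f x \<partial>\<nu>)"
proof -
  have space: "space \<nu> = space \<mu>" "space (mix_measure t \<mu> \<nu>) = space \<mu>"
    using sets sets_eq_imp_space_eq[of \<nu> \<mu>] sets_eq_imp_space_eq[of "mix_measure t \<mu> \<nu>" \<mu>] by simp_all
  have meas [simp]: "g \<in> borel_measurable \<nu> \<longleftrightarrow> g \<in> borel_measurable \<mu>"
    "g \<in> borel_measurable (mix_measure t \<mu> \<nu>) \<longleftrightarrow> g \<in> borel_measurable \<mu>"
    for g :: "'a \<Rightarrow> ennreal"
    using sets by (simp_all cong: measurable_cong_sets)
  \<comment> \<open>Induction over nonnegative Borel functions: the sides agree on indicators by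
    \<open>emeasure_mix_measure\<close>, and both respect sums, nonnegative multiples and increasing
    limits.\<close>
  show ?thesis
    using f
  proof induction
    case (cong f g)
    have "(\<integral>\<^sup>+x. f x \<partial>M) = (\<integral>\<^sup>+x. g x \<partial>M)" if "space M = space \<mu>" for M
      using that cong by (intro nn_integral_cong) simp
    then show ?case using cong space by simp
  next
    case (set A)
    then show ?case
      using sets by (simp add: emeasure_mix_measure)
  next
    case (mult g c)
    then show ?case by (simp add: nn_integral_cmult algebra_simps)
  next
    case (add g h)
    then show ?case by (simp add: nn_integral_add algebra_simps)
  next
    case (seq U)
    \<comment> \<open>Monotonicity in \<open>i\<close> allows the sum of two suprema to be merged
      into one supremum over a common index.\<close>
    have inc: "incseq (\<lambda>i. \<integral>\<^sup>+x. U i x \<partial>M)" for M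
      using \<open>incseq U\<close> by (auto simp: incseq_def le_fun_def intro!: nn_integral_mono)
    have "(\<integral>\<^sup>+x. (SUP i. U i) x \<partial>M) = (SUP i. \<integral>\<^sup>+x. U i x \<partial>M)"
      if "\<And>i. U i \<in> borel_measurable M" for M
      using nn_integral_monotone_convergence_SUP[OF \<open>incseq U\<close> that] by (simp add: image_comp)
    then show ?case
      using seq inc
      by (simp add: SUP_mult_left_ennreal ennreal_SUP_add incseq_def mult_left_mono)
  qed
qed

text \<open>Since \<open>ennreal\<close> truncates negative values to 0,
  \<open>ennreal (f x)\<close> and \<open>ennreal (- f x)\<close> are the positive and negative
  parts of \<open>f\<close>; the nonnegative formula applies to each, and the results are
  subtracted.\<close>

lemma
  fixes f :: "'a \<Rightarrow> real"
  assumes sets: "sets \<nu> = sets \<mu>" and t: "0 \<le> t" "t \<le> 1"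
    and f: "integrable \<mu> f" "integrable \<nu> f"
  shows integrable_mix_measure: "integrable (mix_measure t \<mu> \<nu>) f"
    and integral_mix_measure:
      "(\<integral>x. f x \<partial>mix_measure t \<mu> \<nu>) = (1 - t) * (\<integral>x. f x \<partial>\<mu>) + t * (\<integral>x. f x \<partial>\<nu>)"
proof -
  have f_meas [measurable]: "f \<in> borel_measurable \<mu>" using f by simp
  have meas: "f \<in> borel_measurable (mix_measure t \<mu> \<nu>)"
    by (simp cong: measurable_cong_sets)
  show int: "integrable (mix_measure t \<mu> \<nu>) f"
    using f meas unfolding real_integrable_def
    by (simp add: nn_integral_mix_measure[OF sets] ennreal_mult_eq_top_iff)
  \<comment> \<open>\<open>enn2real\<close> sends infinity to 0, so it is additive only on finite
    values.\<close>
  have fin: "(\<integral>\<^sup>+x. ennreal (g x) \<partial>M) \<noteq> \<infinity>"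
    if "integrable M f" "g = f \<or> g = (\<lambda>x. - f x)" for M :: "'a measure" and g
    using that unfolding real_integrable_def by auto
  have part: "enn2real (\<integral>\<^sup>+x. ennreal (g x) \<partial>mix_measure t \<mu> \<nu>) =
      (1 - t) * enn2real (\<integral>\<^sup>+x. ennreal (g x) \<partial>\<mu>) + t * enn2real (\<integral>\<^sup>+x. ennreal (g x) \<partial>\<nu>)"
    if "g = f \<or> g = (\<lambda>x. - f x)" for g
  proof -
    have "(\<lambda>x. ennreal (g x)) \<in> borel_measurable \<mu>" using that by auto
    then show ?thesis
      using fin[OF f(1) that] fin[OF f(2) that] t
      by (simp add: nn_integral_mix_measure[OF sets] enn2real_plus ennreal_mult_less_top
          enn2real_mult less_top)
  qed
  show "(\<integral>x. f x \<partial>mix_measure t \<mu> \<nu>) = (1 - t) * (\<integral>x. f x \<partial>\<mu>) + t * (\<integral>x. f x \<partial>\<nu>)"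
    unfolding real_lebesgue_integral_def[OF int] real_lebesgue_integral_def[OF f(1)]
      real_lebesgue_integral_def[OF f(2)]
    using part[of f] part[of "\<lambda>x. - f x"] by (simp add: algebra_simps)
qed

text \<open>Tychonoff's theorem for a product of finite sets.\<close>

lemma compact_shift_space: "compact (shift_space d)"
proof -
  have eq: "shift_space d = (\<Pi>\<^sub>E n\<in>UNIV. {1..d})"
    by (auto simp: shift_space_def PiE_UNIV_domain)
  have "compactin (product_topology (\<lambda>_. euclidean) UNIV) (shift_space d)"
    unfolding eq compactin_PiE by (simp add: finite_imp_compact)
  then show ?thesis by (simp add: euclidean_product_topology)
qed

lemma shift_measurable [measurable]: "shift \<in> measurable (shift_borel d) (shift_borel d)"
proof (rule measurable_restrict_space2)
  show "shift \<in> space (shift_borel d) \<rightarrow> shift_space d"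
    by (auto simp: space_restrict_space shift_space_def shift_def)
  have "continuous_on UNIV shift"
    unfolding shift_def by (intro continuous_on_coordinatewise_then_product) simp
  then show "shift \<in> borel_measurable (shift_borel d)"
    by (intro measurable_restrict_space1 borel_measurable_continuous_onI)
qed

lemma continuous_on_prepend: "continuous_on S (prepend a)"
proof (rule continuous_on_coordinatewise_then_product)
  show "continuous_on S (\<lambda>x. prepend a x n)" for n
    by (cases n) (auto simp: prepend_def intro: continuous_on_subset[OF continuous_on_product_coordinates])
qed

lemma prepend_in_shift_space:
  "a \<in> {1..d} \<Longrightarrow> x \<in> shift_space d \<Longrightarrow> prepend a x \<in> shift_space d"
  by (auto simp: shift_space_def prepend_def split: nat.splits)

lemma continuous_on_q_log_ratio:
  assumes "q < 1" and u: "u \<in> pos_continuous d"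
  shows "continuous_on (shift_space d) (\<lambda>x. q_log q ((\<Sum>a\<in>{1..d}. u (prepend a x)) / u x))"
proof -
  have "continuous_on (shift_space d) (\<lambda>x. u (prepend a x))" if "a \<in> {1..d}" for a
    by (rule continuous_on_compose2[of "shift_space d" u])
      (use u that prepend_in_shift_space in \<open>auto simp: pos_continuous_def continuous_on_prepend\<close>)
  \<comment> \<open>The exponent \<open>1 - q\<close> is positive, so the power is continuous on all
    of the closed half-line and a nonnegative base suffices.\<close>
  moreover have "0 \<le> (\<Sum>a\<in>{1..d}. u (prepend a x)) / u x" if "x \<in> shift_space d" for x
    using u that prepend_in_shift_space[OF _ that]
    by (intro divide_nonneg_nonneg sum_nonneg) (auto simp: pos_continuous_def less_imp_le)
  moreover have "continuous_on (shift_space d) u" "\<forall>x\<in>shift_space d. u x \<noteq> 0"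
    using u by (auto simp: pos_continuous_def)
  ultimately show ?thesis
    unfolding q_log_def
    by (intro continuous_on_mult_left continuous_on_diff continuous_on_powr' continuous_on_divide
        continuous_on_sum continuous_on_const) (use assms(1) in auto)
qed

text \<open>By compactness \<open>f\<close> is bounded on the space of \<open>\<mu>\<close>, and a
  bounded measurable function is integrable for a finite measure. Values of \<open>f\<close> outside
  \<open>shift_space d\<close> are never seen by \<open>\<mu>\<close>.\<close>

lemma integrable_continuous_on_shift_space:
  fixes f :: "(nat \<Rightarrow> nat) \<Rightarrow> real"
  assumes "finite_measure \<mu>" and sets: "sets \<mu> = sets (shift_borel d)"
    and f: "continuous_on (shift_space d) f"
  shows "integrable \<mu> f"
proof -
  interpret finite_measure \<mu> by fact
  have space: "space \<mu> = shift_space d"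
    using sets_eq_imp_space_eq[OF sets] by (simp add: space_restrict_space)
  obtain B where "\<And>x. x \<in> shift_space d \<Longrightarrow> norm (f x) \<le> B"
    using compact_imp_bounded[OF compact_continuous_image[OF f compact_shift_space]]
    by (auto simp: bounded_iff)
  moreover have "f \<in> borel_measurable \<mu>"
    using borel_measurable_continuous_on_restrict[OF f] sets by (simp cong: measurable_cong_sets)
  ultimately show ?thesis
    by (intro integrable_const_bound[of _ B]) (auto simp: space)
qed

lemma mix_measure_in_invariant_measures:
  assumes \<mu>: "\<mu> \<in> invariant_measures d" and \<nu>: "\<nu> \<in> invariant_measures d"
    and t: "0 \<le> t" "t \<le> 1"
  shows "mix_measure t \<mu> \<nu> \<in> invariant_measures d"
proof -
  have sets: "sets \<mu> = sets (shift_borel d)" "sets \<nu> = sets \<mu>"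
    using \<mu> \<nu> by (auto simp: invariant_measures_def)
  have space: "space \<nu> = space \<mu>" "space (mix_measure t \<mu> \<nu>) = space \<mu>"
    using sets sets_eq_imp_space_eq[of \<nu> \<mu>] sets_eq_imp_space_eq[of "mix_measure t \<mu> \<nu>" \<mu>] by simp_all
  have unit: "ennreal (1 - t) + ennreal t = 1"
    using t by (simp flip: ennreal_plus)
  have "prob_space (mix_measure t \<mu> \<nu>)"
  proof (rule prob_spaceI)
    have "emeasure \<mu> (space \<mu>) = 1" "emeasure \<nu> (space \<mu>) = 1"
      using \<mu> \<nu> space prob_space.emeasure_space_1 by (force simp: invariant_measures_def)+
    then show "emeasure (mix_measure t \<mu> \<nu>) (space (mix_measure t \<mu> \<nu>)) = 1"
      using unit by (simp add: space emeasure_mix_measure[OF sets(2)])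
  qed
  moreover have "emeasure (mix_measure t \<mu> \<nu>) (shift -` A \<inter> space \<mu>) =
      emeasure (mix_measure t \<mu> \<nu>) A" if A: "A \<in> sets \<mu>" for A
  proof -
    \<comment> \<open>\<open>emeasure_mix_measure\<close> evaluates the mixture on measurable sets
      only, so the preimage must be shown measurable before invariance can be checked
      termwise.\<close>
    have "shift \<in> measurable \<mu> \<mu>"
      using shift_measurable[of d] sets by (simp cong: measurable_cong_sets)
    then have "shift -` A \<inter> space \<mu> \<in> sets \<mu>"
      using A by (rule measurable_sets)
    then show ?thesis
      using A \<mu> \<nu> sets space by (simp add: emeasure_mix_measure invariant_measures_def)
  qed
  ultimately show ?thesis
    using sets space by (simp add: invariant_measures_def)
qed

theorem lemma3p4:
  fixes q :: real and d :: nat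
  assumes "0 < q" and "q < 1"
  shows "concave_on_measures (invariant_measures d) (q_entropy q d)"
  unfolding concave_on_measures_def
proof (intro ballI conjI)
  fix \<mu> \<nu> and t :: real
  assume \<mu>: "\<mu> \<in> invariant_measures d" and \<nu>: "\<nu> \<in> invariant_measures d" and t: "t \<in> {0..1}"
  then show "mix_measure t \<mu> \<nu> \<in> invariant_measures d"
    by (simp add: mix_measure_in_invariant_measures)
  let ?f = "\<lambda>u x. q_log q ((\<Sum>a\<in>{1..d}. u (prepend a x)) / u x)"
  \<comment> \<open>A real infimum is a lower bound of its family only if the family is bounded
    below; \<open>q_entropy_bdd_below\<close> supplies this.\<close>
  have upper: "q_entropy q d \<rho> \<le> (\<integral>x. ?f u x \<partial>\<rho>)"
    if "\<rho> \<in> invariant_measures d" "u \<in> pos_continuous d" for \<rho> u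
    unfolding q_entropy_def by (rule cINF_lower[OF q_entropy_bdd_below[OF assms that(1)] that(2)])
  \<comment> \<open>Without integrability the integral would default to 0 and affinity in the
    measure could fail.\<close>
  have int: "integrable \<rho> (?f u)"
    if "\<rho> \<in> invariant_measures d" "u \<in> pos_continuous d" for \<rho> u
    using that continuous_on_q_log_ratio[OF assms(2) that(2)]
    by (intro integrable_continuous_on_shift_space)
      (auto simp: invariant_measures_def prob_space_def)
  show "(1 - t) * q_entropy q d \<mu> + t * q_entropy q d \<nu> \<le> q_entropy q d (mix_measure t \<mu> \<nu>)"
    unfolding q_entropy_def[of q d "mix_measure t \<mu> \<nu>"]
  proof (rule cINF_greatest)
    show "pos_continuous d \<noteq> {}"
      using pos_continuous_nonempty by blast
    fix u assume u: "u \<in> pos_continuous d"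
    \<comment> \<open>One common \<open>u\<close> is tested against both entropies. The inequality
      may be strict, since the two infima may be approached along different functions.\<close>
    have "(1 - t) * q_entropy q d \<mu> + t * q_entropy q d \<nu> \<le>
        (1 - t) * (\<integral>x. ?f u x \<partial>\<mu>) + t * (\<integral>x. ?f u x \<partial>\<nu>)"
      using t upper[OF \<mu> u] upper[OF \<nu> u] by (intro add_mono mult_left_mono) auto
    also have "\<dots> = (\<integral>x. ?f u x \<partial>mix_measure t \<mu> \<nu>)"
      using t \<mu> \<nu> u int by (intro integral_mix_measure[symmetric]) (auto simp: invariant_measures_def)
    finally show "(1 - t) * q_entropy q d \<mu> + t * q_entropy q d \<nu> \<le> (\<integral>x. ?f u x \<partial>mix_measure t \<mu> \<nu>)" .
  qed
qed

end
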